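(* Let $R$ be a commutative ring with unity, $Y\subseteq\mathrm{Spec}(R)$, $I$ an ideal of $R$ and $\mathscr{F}$ an $\mathcal{H}_Y$-filter on $Y$. The following statements hold. (a) $\mathcal{H}_Y^{-1}(\mathscr{F})$ is a prime strong $\mathcal{H}_Y$-ideal if and only if $\mathscr{F}$ is a prime $\mathcal{H}_Y$-filter. (b) If $I$ is a strong $\mathcal{H}_Y$-ideal, then $I$ is a prime ideal of $R$ if and only if $\mathcal{H}_Y(I)$ is a prime $\mathcal{H}_Y$-filter. (c) The mapping $J\mapsto\mathcal{H}_Y(J)$ is one-to-one from the set of all prime strong $\mathcal{H}_Y$-ideals onto the set of all prime $\mathcal{H}_Y$-filters. (d) $I$ is a maximal proper strong $\mathcal{H}_Y$-ideal (i.e. maximal among the proper strong $\mathcal{H}_Y$-ideals) if and only if there exists an $\mathcal{H}_Y$-ultrafilter $\mathscr{G}$ such that $I=\mathcal{H}_Y^{-1}(\mathscr{G})$. In addition, the mapping $J\mapsto\mathcal{H}_Y(J)$ is one-to-one from the set of all maximal proper strong $\mathcal{H}_Y$-ideals onto the set of all $\mathcal{H}_Y$-ultrafilters. (e) Assume $\mathrm{Max}(R)\subseteq Y$. If $I$ is a maximal ideal, then $\mathcal{H}_Y(I)$ is an $\mathcal{H}_Y$-ultrafilter. If $I$ is a strong $\mathcal{H}_Y$-ideal, the converse is also true. (f) If $\mathrm{Max}(R)\subseteq Y$, then $\mathscr{F}$ is an $\mathcal{H}_Y$-ultrafilter if and only if $\mathcal{H}_Y^{-1}(\mathscr{F})$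 is a maximal ideal.
   Context: $h_Y(S)=\{P\in Y: S\subseteq P\}$ for $S\subseteq R$, and $h_Y(a)=h_Y(\{a\})$. $\mathcal{H}_Y=\{h_Y(F): F\subseteq R\text{ finite}\}$; it is closed under finite unions and intersections, hence is a bounded distributive lattice under inclusion, with top $Y$ and bottom $\emptyset$. An $\mathcal{H}_Y$-filter on $Y$ is a (nonempty, not necessarily proper) filter of this lattice, i.e. a nonempty subset of $\mathcal{H}_Y$ closed under finite intersections and under supersets belonging to $\mathcal{H}_Y$. A prime $\mathcal{H}_Y$-filter is a proper $\mathcal{H}_Y$-filter $\mathscr{P}$ such that for $A,B\in\mathcal{H}_Y$, $A\cup B\in\mathscr{P}$ implies $A\in\mathscr{P}$ or $B\in\mathscr{P}$; an $\mathcal{H}_Y$-ultrafilter is a maximal proper $\mathcal{H}_Y$-filter. For an ideal $I$, $\mathcal{H}_Y(I)=\{h_Y(S): S\subseteq I\text{ finite}\}$ (an $\mathcal{H}_Y$-filter), and for an $\mathcal{H}_Y$-filter $\mathscr{F}$, $\mathcal{H}_Y^{-1}(\mathscr{F})=\{a\in R: h_Y(a)\in\mathscr{F}\}$ (an ideal). An ideal $I$ (not necessarily proper) is a strong $\mathcal{H}_Y$-ideal if for every finite $F\subseteq I$ and every $b\in R$, $h_Y(F)\subseteq h_Y(b)$ implies $b\in I$. $\mathrm{Max}(R)$ is the set of maximal ideals of $R$. *)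

theory Defs
  imports "HOL-Algebra.Ideal"
begin

text \<open>
  The ring is an explicit HOL-Algebra structure, so the zero ring is allowed.
  Throughout, \<open>Y\<close> is meant to be a subset of \<open>Spec R\<close>.
\<close>

definition Spec :: "('a, 'b) ring_scheme \<Rightarrow> 'a set set"
  where "Spec R = {P. primeideal P R}"

definition Max_Spec :: "('a, 'b) ring_scheme \<Rightarrow> 'a set set"
  where "Max_Spec R = {M. maximalideal M R}"

text \<open>\<open>hY Y S\<close> is $h_Y(S)$; $h_Y(a)$ is written \<open>hY Y {a}\<close>.\<close>

definition hY :: "'a set set \<Rightarrow> 'a set \<Rightarrow> 'a set set"
  where "hY Y S = {P \<in> Y. S \<subseteq> P}"

definition HY :: "('a, 'b) ring_scheme \<Rightarrow> 'a set set \<Rightarrow> 'a set set set"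
  where "HY R Y = {hY Y S | S. finite S \<and> S \<subseteq> carrier R}"

text \<open>A filter need not be proper: \<open>HY R Y\<close> itself is one.\<close>

definition HY_filter :: "('a, 'b) ring_scheme \<Rightarrow> 'a set set \<Rightarrow> 'a set set set \<Rightarrow> bool"
  where "HY_filter R Y \<F> \<longleftrightarrow>
    \<F> \<subseteq> HY R Y \<and> \<F> \<noteq> {} \<and>
    (\<forall>A \<in> \<F>. \<forall>B \<in> \<F>. A \<inter> B \<in> \<F>) \<and>
    (\<forall>A \<in> \<F>. \<forall>B \<in> HY R Y. A \<subseteq> B \<longrightarrow> B \<in> \<F>)"

definition proper_HY_filter :: "('a, 'b) ring_scheme \<Rightarrow> 'a set set \<Rightarrow> 'a set set set \<Rightarrow> bool"
  where "proper_HY_filter R Y \<F> \<longleftrightarrow> HY_filter R Y \<F> \<and> \<F> \<noteq> HY R Y"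

definition prime_HY_filter :: "('a, 'b) ring_scheme \<Rightarrow> 'a set set \<Rightarrow> 'a set set set \<Rightarrow> bool"
  where "prime_HY_filter R Y \<P> \<longleftrightarrow>
    proper_HY_filter R Y \<P> \<and>
    (\<forall>A \<in> HY R Y. \<forall>B \<in> HY R Y. A \<union> B \<in> \<P> \<longrightarrow> A \<in> \<P> \<or> B \<in> \<P>)"

definition HY_ultrafilter :: "('a, 'b) ring_scheme \<Rightarrow> 'a set set \<Rightarrow> 'a set set set \<Rightarrow> bool"
  where "HY_ultrafilter R Y \<U> \<longleftrightarrow>
    proper_HY_filter R Y \<U> \<and>
    (\<forall>\<G>. proper_HY_filter R Y \<G> \<longrightarrow> \<U> \<subseteq> \<G> \<longrightarrow> \<G> = \<U>)"

definition HY_of :: "'a set set \<Rightarrow> 'a set \<Rightarrow> 'a set set set"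
  where "HY_of Y I = {hY Y S | S. finite S \<and> S \<subseteq> I}"

definition HY_inv :: "('a, 'b) ring_scheme \<Rightarrow> 'a set set \<Rightarrow> 'a set set set \<Rightarrow> 'a set"
  where "HY_inv R Y \<F> = {a \<in> carrier R. hY Y {a} \<in> \<F>}"

definition strong_HY_ideal :: "('a, 'b) ring_scheme \<Rightarrow> 'a set set \<Rightarrow> 'a set \<Rightarrow> bool"
  where "strong_HY_ideal R Y I \<longleftrightarrow>
    ideal I R \<and>
    (\<forall>S b. finite S \<longrightarrow> S \<subseteq> I \<longrightarrow> b \<in> carrier R \<longrightarrow> hY Y S \<subseteq> hY Y {b} \<longrightarrow> b \<in> I)"

definition prime_strong_HY_ideal :: "('a, 'b) ring_scheme \<Rightarrow> 'a set set \<Rightarrow> 'a set \<Rightarrow> bool"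
  where "prime_strong_HY_ideal R Y I \<longleftrightarrow> strong_HY_ideal R Y I \<and> primeideal I R"

text \<open>Maximality is among the proper strong ideals only, not among all proper ideals.\<close>

definition maximal_strong_HY_ideal :: "('a, 'b) ring_scheme \<Rightarrow> 'a set set \<Rightarrow> 'a set \<Rightarrow> bool"
  where "maximal_strong_HY_ideal R Y I \<longleftrightarrow>
    strong_HY_ideal R Y I \<and> I \<noteq> carrier R \<and>
    (\<forall>J. strong_HY_ideal R Y J \<longrightarrow> J \<noteq> carrier R \<longrightarrow> I \<subseteq> J \<longrightarrow> J = I)"

end

theory Submission
  imports Defs "HOL-Algebra.Ring_Divisibility"
begin

text \<open>
  \<open>HY_of Y\<close> and \<open>HY_inv R Y\<close> are mutually inverse, inclusion preserving bijections
  between the strong ideals and all filters, and they match the improper members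
  \<open>carrier R\<close> and \<open>HY R Y\<close>. Hence they match the maximal proper members, and they match
  the prime ones because $h_Y(ab) = h_Y(a) \cup h_Y(b)$. If \<open>Max_Spec R \<subseteq> Y\<close>, every maximal
  ideal $M$ is strong, as $M \in h_Y(S)$ for each $S \subseteq M$; since every proper ideal lies in
  a maximal one, the maximal strong ideals are then exactly the maximal ideals.
\<close>

section \<open>Existence of maximal ideals\<close>

text \<open>Zorn's lemma, with properness expressed as omitting \<open>\<one>\<close>: in this form
  it visibly passes to unions of chains.\<close>

lemma (in cring) ex_maximalideal_superset:
  assumes "ideal I R" and "I \<noteq> carrier R"
  obtains M where "maximalideal M R" and "I \<subseteq> M"
proof -
  define \<A> where "\<A> = {J. ideal J R \<and> I \<subseteq> J \<and> \<one> \<notin> J}"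
  have "I \<in> \<A>"
    using assms ideal.one_imp_carrier by (auto simp: \<A>_def)
  have "\<exists>M\<in>\<A>. \<forall>J\<in>\<A>. M \<subseteq> J \<longrightarrow> J = M"
  proof (rule subset_Zorn_nonempty)
    show "\<A> \<noteq> {}"
      using \<open>I \<in> \<A>\<close> by blast
  next
    fix \<C> assume "\<C> \<noteq> {}" and "subset.chain \<A> \<C>"
    then have "\<C> \<subseteq> \<A>"
      by (simp add: pred_on.chain_def)
    moreover have "subset.chain {J. ideal J R} \<C>"
      using \<open>subset.chain \<A> \<C>\<close> by (auto simp: pred_on.chain_def \<A>_def)
    then have "ideal (\<Union>\<C>) R"
      using chain_Union_is_ideal[of \<C>] \<open>\<C> \<noteq> {}\<close> by simp
    ultimately show "\<Union>\<C> \<in> \<A>"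
      using \<open>\<C> \<noteq> {}\<close> by (auto simp: \<A>_def)
  qed
  then obtain M where "M \<in> \<A>" and M: "\<And>J. J \<in> \<A> \<Longrightarrow> M \<subseteq> J \<Longrightarrow> J = M"
    by blast
  have "maximalideal M R"
  proof (rule maximalidealI)
    show "ideal M R" and "carrier R \<noteq> M"
      using \<open>M \<in> \<A>\<close> by (auto simp: \<A>_def)
  next
    fix J assume "ideal J R" and "M \<subseteq> J"
    then show "J = M \<or> J = carrier R"
      using M[of J] \<open>M \<in> \<A>\<close> ideal.one_imp_carrier by (auto simp: \<A>_def)
  qed
  then show thesis
    using that \<open>M \<in> \<A>\<close> by (simp add: \<A>_def)
qed

section \<open>Elementary properties of \<open>hY\<close> and of filters\<close>

lemma hY_Un: "hY Y (S \<union> T) = hY Y S \<inter> hY Y T"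
  by (auto simp: hY_def)

lemma HY_of_mono: "I \<subseteq> J \<Longrightarrow> HY_of Y I \<subseteq> HY_of Y J"
  by (auto simp: HY_of_def)

lemma HY_inv_mono: "\<F> \<subseteq> \<G> \<Longrightarrow> HY_inv R Y \<F> \<subseteq> HY_inv R Y \<G>"
  by (auto simp: HY_inv_def)

lemma HY_of_carrier: "HY_of Y (carrier R) = HY R Y"
  by (simp add: HY_of_def HY_def)

lemma hY_mem_HY: "\<lbrakk>finite S; S \<subseteq> carrier R\<rbrakk> \<Longrightarrow> hY Y S \<in> HY R Y"
  by (auto simp: HY_def)

lemma HY_inv_HY: "HY_inv R Y (HY R Y) = carrier R"
  by (auto simp: HY_inv_def intro: hY_mem_HY)

lemma HY_filter_Int: "\<lbrakk>HY_filter R Y \<F>; A \<in> \<F>; B \<in> \<F>\<rbrakk> \<Longrightarrow> A \<inter> B \<in> \<F>"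
  by (simp add: HY_filter_def)

lemma HY_filter_upward: "\<lbrakk>HY_filter R Y \<F>; A \<in> \<F>; B \<in> HY R Y; A \<subseteq> B\<rbrakk> \<Longrightarrow> B \<in> \<F>"
  by (auto simp: HY_filter_def)

lemma HY_filter_top:
  assumes "HY_filter R Y \<F>"
  shows "Y \<in> \<F>"
proof -
  obtain A where A: "A \<in> \<F>"
    using assms by (auto simp: HY_filter_def)
  then have "A \<subseteq> Y"
    using assms by (auto simp: HY_filter_def HY_def hY_def)
  moreover have "Y \<in> HY R Y"
    using hY_mem_HY[of "{}" R Y] by (simp add: hY_def)
  ultimately show ?thesis
    using HY_filter_upward[OF assms A] by blast
qed

lemma strong_HY_idealD:
  "\<lbrakk>strong_HY_ideal R Y I; finite S; S \<subseteq> I; b \<in> carrier R; hY Y S \<subseteq> hY Y {b}\<rbrakk> \<Longrightarrow> b \<in> I"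
  unfolding strong_HY_ideal_def by blast

text \<open>\<open>hY Y S\<close> is the finite intersection of the sets \<open>hY Y {s}\<close>,
  and equals the top \<open>Y\<close> when \<open>S\<close> is empty. Membership in a filter thus
  reduces to single elements, so a filter is determined by its ideal.\<close>

lemma hY_mem_filter_iff:
  assumes "HY_filter R Y \<F>" and "finite S" and "S \<subseteq> carrier R"
  shows "hY Y S \<in> \<F> \<longleftrightarrow> S \<subseteq> HY_inv R Y \<F>"
proof
  assume "hY Y S \<in> \<F>"
  have "s \<in> HY_inv R Y \<F>" if "s \<in> S" for s
  proof -
    have "s \<in> carrier R" and "hY Y S \<subseteq> hY Y {s}"
      using assms that by (auto simp: hY_def)
    then show ?thesis
      using HY_filter_upward[OF assms(1) \<open>hY Y S \<in> \<F>\<close>, of "hY Y {s}"]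
      by (simp add: HY_inv_def hY_mem_HY)
  qed
  then show "S \<subseteq> HY_inv R Y \<F>"
    by blast
next
  assume "S \<subseteq> HY_inv R Y \<F>"
  with \<open>finite S\<close> show "hY Y S \<in> \<F>"
  proof (induction S)
    case empty
    then show ?case
      using HY_filter_top[OF assms(1)] by (simp add: hY_def)
  next
    case (insert s S)
    then show ?case
      using HY_filter_Int[OF assms(1)] hY_Un[of Y "{s}" S] by (simp add: HY_inv_def)
  qed
qed

section \<open>The two maps are mutually inverse\<close>

lemma HY_of_HY_inv:
  assumes "HY_filter R Y \<F>"
  shows "HY_of Y (HY_inv R Y \<F>) = \<F>"
proof
  have "HY_inv R Y \<F> \<subseteq> carrier R"
    by (auto simp: HY_inv_def)
  then show "HY_of Y (HY_inv R Y \<F>) \<subseteq> \<F>"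
    using hY_mem_filter_iff[OF assms] by (fastforce simp: HY_of_def)
  show "\<F> \<subseteq> HY_of Y (HY_inv R Y \<F>)"
  proof
    fix A assume "A \<in> \<F>"
    then obtain S where "A = hY Y S" "finite S" "S \<subseteq> carrier R"
      using assms by (auto simp: HY_filter_def HY_def)
    then show "A \<in> HY_of Y (HY_inv R Y \<F>)"
      using \<open>A \<in> \<F>\<close> hY_mem_filter_iff[OF assms] by (auto simp: HY_of_def)
  qed
qed

text \<open>If \<open>hY Y {a}\<close> lies in \<open>HY_of Y I\<close>, it equals
  \<open>hY Y S\<close> for some finite \<open>S \<subseteq> I\<close>, and strongness puts
  \<open>a\<close> into \<open>I\<close>.\<close>

lemma HY_inv_HY_of:
  assumes "strong_HY_ideal R Y I"
  shows "HY_inv R Y (HY_of Y I) = I"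
proof
  show "HY_inv R Y (HY_of Y I) \<subseteq> I"
    using strong_HY_idealD[OF assms] by (auto simp: HY_inv_def HY_of_def)
  have "I \<subseteq> carrier R"
    using assms ideal.Icarr by (auto simp: strong_HY_ideal_def)
  then show "I \<subseteq> HY_inv R Y (HY_of Y I)"
    unfolding HY_inv_def HY_of_def by blast
qed

text \<open>The classes \<open>P\<close> and \<open>Q\<close> stay abstract so that one argument,
  with inverse \<open>HY_inv R Y\<close>, serves both the prime and the maximal case.\<close>

lemma bij_betw_HY_of:
  assumes "\<And>J. P J \<Longrightarrow> strong_HY_ideal R Y J \<and> Q (HY_of Y J)"
    and "\<And>\<G>. Q \<G> \<Longrightarrow> HY_filter R Y \<G> \<and> P (HY_inv R Y \<G>)"
  shows "bij_betw (HY_of Y) {J. P J} {\<G>. Q \<G>}"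
  by (rule bij_betw_byWitness[where f' = "HY_inv R Y"])
    (use assms HY_inv_HY_of HY_of_HY_inv in fast)+

section \<open>Ideals and filters over a set of prime ideals\<close>

locale spectrum_subset = cring R for R (structure) +
  fixes Y :: "'a set set"
  assumes Y_subset: "Y \<subseteq> Spec R"
begin

lemma primeideal_if_mem: "P \<in> Y \<Longrightarrow> primeideal P R"
  using Y_subset by (auto simp: Spec_def)

lemma ideal_if_mem: "P \<in> Y \<Longrightarrow> ideal P R"
  using primeideal.axioms(1) primeideal_if_mem by blast

text \<open>Primality of the members of \<open>Y\<close> gives one inclusion, absorption the
  other.\<close>

lemma hY_mult:
  assumes "a \<in> carrier R" and "b \<in> carrier R"
  shows "hY Y {a \<otimes> b} = hY Y {a} \<union> hY Y {b}"
  using assms primeideal.I_prime[OF primeideal_if_mem]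
    ideal.I_l_closed[OF ideal_if_mem] ideal.I_r_closed[OF ideal_if_mem]
  by (fastforce simp: hY_def)

text \<open>The real content is upward closure. If \<open>hY Y S \<subseteq> hY Y T\<close> with
  \<open>S \<subseteq> I\<close>, then \<open>hY Y T\<close> is also the union of the two sets, and
  this union is cut out by the products of elements of \<open>S\<close> and \<open>T\<close>, which
  lie in \<open>I\<close>.\<close>

lemma HY_filter_HY_of:
  assumes "ideal I R"
  shows "HY_filter R Y (HY_of Y I)"
proof -
  interpret I: ideal I R by fact
  have upward: "hY Y T \<in> HY_of Y I"
    if S: "finite S" "S \<subseteq> I" and T: "finite T" "T \<subseteq> carrier R" and sub: "hY Y S \<subseteq> hY Y T" for S T
  proof -
    let ?U = "(\<lambda>(s, t). s \<otimes> t) ` (S \<times> T)"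
    have "hY Y T = hY Y ?U"
    proof
      show "hY Y T \<subseteq> hY Y ?U"
      proof
        fix P assume P: "P \<in> hY Y T"
        then have "ideal P R"
          by (simp add: hY_def ideal_if_mem)
        with P S T show "P \<in> hY Y ?U"
          by (auto simp: hY_def subset_iff intro!: ideal.I_l_closed)
      qed
      show "hY Y ?U \<subseteq> hY Y T"
      proof
        fix P assume P: "P \<in> hY Y ?U"
        then interpret P: primeideal P R
          by (simp add: hY_def primeideal_if_mem)
        show "P \<in> hY Y T"
        proof (cases "S \<subseteq> P")
          case True
          then show ?thesis
            using P sub by (auto simp: hY_def)
        next
          case False
          then obtain s where s: "s \<in> S" "s \<notin> P"
            by blast
          \<comment> \<open>One element of \<open>S\<close> outside the prime \<open>P\<close>
            suffices: all its products with \<open>T\<close> lie in \<open>P\<close>, which forces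
            \<open>T \<subseteq> P\<close>.\<close>
          have "t \<in> P" if "t \<in> T" for t
          proof -
            have "s \<otimes> t \<in> P"
              using P s that by (auto simp: hY_def)
            then show ?thesis
              using P.I_prime[of s t] s S T that I.Icarr by blast
          qed
          then show ?thesis
            using P by (auto simp: hY_def)
        qed
      qed
    qed
    moreover have "?U \<subseteq> I"
      using S T by (auto intro!: I.I_r_closed)
    ultimately show ?thesis
      using S T by (auto simp: HY_of_def)
  qed
  show ?thesis
    unfolding HY_filter_def
  proof (intro conjI ballI impI)
    show "HY_of Y I \<subseteq> HY R Y"
      using HY_of_mono[OF I.a_subset] HY_of_carrier by metis
    show "HY_of Y I \<noteq> {}"
      by (auto simp: HY_of_def)
  next
    fix A B assume "A \<in> HY_of Y I" and "B \<in> HY_of Y I"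
    then obtain S T where "A = hY Y S" "finite S" "S \<subseteq> I" "B = hY Y T" "finite T" "T \<subseteq> I"
      by (auto simp: HY_of_def)
    then have "A \<inter> B = hY Y (S \<union> T)" and "finite (S \<union> T)" and "S \<union> T \<subseteq> I"
      by (simp_all add: hY_Un)
    then show "A \<inter> B \<in> HY_of Y I"
      unfolding HY_of_def by blast
  next
    fix A B assume A: "A \<in> HY_of Y I" and B: "B \<in> HY R Y" and "A \<subseteq> B"
    obtain S where "A = hY Y S" "finite S" "S \<subseteq> I"
      using A by (auto simp: HY_of_def)
    moreover obtain T where "B = hY Y T" "finite T" "T \<subseteq> carrier R"
      using B by (auto simp: HY_def)
    ultimately show "B \<in> HY_of Y I"
      using upward \<open>A \<subseteq> B\<close> by blast
  qed
qed

text \<open>The strongness condition \<open>mem\<close> comes first and yields the ideal axioms: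
  each closure property of the ideals in \<open>Y\<close> becomes an inclusion between sets
  \<open>hY\<close>.\<close>

lemma strong_HY_ideal_HY_inv:
  assumes "HY_filter R Y \<F>"
  shows "strong_HY_ideal R Y (HY_inv R Y \<F>)"
proof -
  let ?I = "HY_inv R Y \<F>"
  have mem: "b \<in> ?I" if "finite S" "S \<subseteq> ?I" "b \<in> carrier R" "hY Y S \<subseteq> hY Y {b}" for S b
  proof -
    have "S \<subseteq> carrier R"
      using that by (auto simp: HY_inv_def)
    then have "hY Y S \<in> \<F>"
      using that hY_mem_filter_iff[OF assms] by blast
    then show ?thesis
      using that HY_filter_upward[OF assms] by (simp add: HY_inv_def hY_mem_HY)
  qed
  have carr: "?I \<subseteq> carrier R"
    by (auto simp: HY_inv_def)
  \<comment> \<open>Strongness is applied to the empty set, since every member of \<open>Y\<close>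
    contains \<open>\<zero>\<close>.\<close>
  have zero: "\<zero> \<in> ?I"
    by (rule mem[of "{}"])
      (auto simp: hY_def intro: additive_subgroup.zero_closed ideal.axioms(1) ideal_if_mem)
  have add: "a \<oplus> b \<in> ?I" if "a \<in> ?I" "b \<in> ?I" for a b
  proof (rule mem[of "{a, b}"])
    show "hY Y {a, b} \<subseteq> hY Y {a \<oplus> b}"
      using additive_subgroup.a_closed[OF ideal.axioms(1)[OF ideal_if_mem]]
      by (auto simp: hY_def)
  qed (use that carr in auto)
  have mult: "x \<otimes> a \<in> ?I" if "a \<in> ?I" "x \<in> carrier R" for a x
  proof (rule mem[of "{a}"])
    show "hY Y {a} \<subseteq> hY Y {x \<otimes> a}"
      using ideal.I_l_closed[OF ideal_if_mem] that by (auto simp: hY_def)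
  qed (use that carr in auto)
  have "ideal ?I R"
  proof (rule idealI)
    show "subgroup ?I (add_monoid R)"
    proof (rule group.subgroupI[OF add.is_group])
      show "inv\<^bsub>add_monoid R\<^esub> a \<in> ?I" if "a \<in> ?I" for a
      proof -
        have "a \<in> carrier R"
          using that carr by blast
        then show ?thesis
          \<comment> \<open>The additive inverse is the multiple by
            \<open>\<ominus> \<one>\<close>.\<close>
          using mult[OF that, of "\<ominus> \<one>"] by (simp add: l_minus flip: a_inv_def)
      qed
    qed (use carr zero add in auto)
    show "a \<otimes> x \<in> ?I" if "a \<in> ?I" "x \<in> carrier R" for a x
      using mult[OF that] that carr by (auto simp: m_comm)
  qed (use mult ring_axioms in auto)
  then show ?thesis
    unfolding strong_HY_ideal_def using mem by blast
qed

section \<open>Transfer of properness, primality and maximality\<close>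

lemma proper_HY_filter_iff:
  assumes "HY_filter R Y \<F>"
  shows "proper_HY_filter R Y \<F> \<longleftrightarrow> HY_inv R Y \<F> \<noteq> carrier R"
  using assms HY_of_HY_inv[OF assms] HY_of_carrier HY_inv_HY
  unfolding proper_HY_filter_def by metis

text \<open>From filter to ideal, \<open>hY_mult\<close> turns products into unions of two sets.
  Conversely, two members of the lattice outside \<open>\<F>\<close> give two elements outside the
  ideal, whose product would lie in it if the union were in \<open>\<F>\<close>.\<close>

lemma prime_HY_filter_iff:
  assumes F: "HY_filter R Y \<F>"
  shows "prime_HY_filter R Y \<F> \<longleftrightarrow> primeideal (HY_inv R Y \<F>) R"
proof
  assume prime: "prime_HY_filter R Y \<F>"
  show "primeideal (HY_inv R Y \<F>) R"
  proof (rule primeidealI)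
    show "ideal (HY_inv R Y \<F>) R"
      using strong_HY_ideal_HY_inv[OF F] by (simp add: strong_HY_ideal_def)
    show "carrier R \<noteq> HY_inv R Y \<F>"
      using prime proper_HY_filter_iff[OF F] by (auto simp: prime_HY_filter_def)
    show "a \<in> HY_inv R Y \<F> \<or> b \<in> HY_inv R Y \<F>"
      if "a \<in> carrier R" "b \<in> carrier R" "a \<otimes> b \<in> HY_inv R Y \<F>" for a b
      using that prime hY_mem_HY[of "{a}" R Y] hY_mem_HY[of "{b}" R Y]
      by (auto simp: prime_HY_filter_def HY_inv_def hY_mult)
  qed (rule is_cring)
next
  assume P: "primeideal (HY_inv R Y \<F>) R"
  have "A \<in> \<F> \<or> B \<in> \<F>" if AB: "A \<in> HY R Y" "B \<in> HY R Y" "A \<union> B \<in> \<F>" for A B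
  proof (rule ccontr)
    assume neg: "\<not> ?thesis"
    obtain S T where S: "A = hY Y S" "finite S" "S \<subseteq> carrier R"
      and T: "B = hY Y T" "finite T" "T \<subseteq> carrier R"
      using AB by (auto simp: HY_def)
    \<comment> \<open>By \<open>hY_mem_filter_iff\<close>, a set \<open>hY Y S\<close> outside
      \<open>\<F>\<close> has a generator outside the ideal.\<close>
    obtain s t where s: "s \<in> S" "s \<notin> HY_inv R Y \<F>" and t: "t \<in> T" "t \<notin> HY_inv R Y \<F>"
      using neg S T hY_mem_filter_iff[OF F S(2,3)] hY_mem_filter_iff[OF F T(2,3)] by auto
    have carr: "s \<in> carrier R" "t \<in> carrier R"
      using s t S T by auto
    have "A \<subseteq> hY Y {s}" and "B \<subseteq> hY Y {t}"
      using s t S(1) T(1) by (auto simp: hY_def)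
    then have "A \<union> B \<subseteq> hY Y {s \<otimes> t}"
      unfolding hY_mult[OF carr] by blast
    then have "hY Y {s \<otimes> t} \<in> \<F>"
      by (rule HY_filter_upward[OF F AB(3) hY_mem_HY, rotated 2]) (use carr in auto)
    then have "s \<otimes> t \<in> HY_inv R Y \<F>"
      using carr by (simp add: HY_inv_def)
    then show False
      using primeideal.I_prime[OF P carr] s t by blast
  qed
  then show "prime_HY_filter R Y \<F>"
    using primeideal.I_notcarr[OF P] proper_HY_filter_iff[OF F] by (auto simp: prime_HY_filter_def)
qed

text \<open>A competitor on one side is carried to the other by an inclusion preserving map that
  respects properness: \<open>J\<close> becomes \<open>HY_of Y J\<close>, and \<open>\<G>\<close>
  becomes \<open>HY_inv R Y \<G>\<close>.\<close>

lemma HY_ultrafilter_iff: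
  assumes F: "HY_filter R Y \<F>"
  shows "HY_ultrafilter R Y \<F> \<longleftrightarrow> maximal_strong_HY_ideal R Y (HY_inv R Y \<F>)"
proof
  assume ultra: "HY_ultrafilter R Y \<F>"
  have "J = HY_inv R Y \<F>"
    if J: "strong_HY_ideal R Y J" "J \<noteq> carrier R" "HY_inv R Y \<F> \<subseteq> J" for J
  proof -
    have "proper_HY_filter R Y (HY_of Y J)"
      using J HY_filter_HY_of[of J] HY_inv_HY_of[OF J(1)] proper_HY_filter_iff
      by (simp add: strong_HY_ideal_def)
    moreover have "\<F> \<subseteq> HY_of Y J"
      using HY_of_mono[OF J(3)] HY_of_HY_inv[OF F] by metis
    ultimately have "HY_of Y J = \<F>"
      using ultra by (simp add: HY_ultrafilter_def)
    then show ?thesis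
      using HY_inv_HY_of[OF J(1)] by simp
  qed
  then show "maximal_strong_HY_ideal R Y (HY_inv R Y \<F>)"
    using ultra strong_HY_ideal_HY_inv[OF F] proper_HY_filter_iff[OF F]
    by (simp add: maximal_strong_HY_ideal_def HY_ultrafilter_def)
next
  assume max: "maximal_strong_HY_ideal R Y (HY_inv R Y \<F>)"
  have "\<G> = \<F>" if G: "proper_HY_filter R Y \<G>" "\<F> \<subseteq> \<G>" for \<G>
  proof -
    have G': "HY_filter R Y \<G>"
      using G by (simp add: proper_HY_filter_def)
    then have "HY_inv R Y \<G> = HY_inv R Y \<F>"
      using max G HY_inv_mono[OF G(2), of R Y] strong_HY_ideal_HY_inv[OF G']
        proper_HY_filter_iff[OF G']
      by (simp add: maximal_strong_HY_ideal_def)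
    then show ?thesis
      using HY_of_HY_inv[OF F] HY_of_HY_inv[OF G'] by simp
  qed
  then show "HY_ultrafilter R Y \<F>"
    using max proper_HY_filter_iff[OF F]
    by (simp add: maximal_strong_HY_ideal_def HY_ultrafilter_def)
qed

text \<open>This and the next lemma restate the transfer from the side of ideals, taking
  \<open>HY_of Y I\<close> as the filter.\<close>

lemma prime_HY_filter_HY_of_iff:
  assumes "strong_HY_ideal R Y I"
  shows "prime_HY_filter R Y (HY_of Y I) \<longleftrightarrow> primeideal I R"
  using assms prime_HY_filter_iff[OF HY_filter_HY_of] HY_inv_HY_of[OF assms]
  by (simp add: strong_HY_ideal_def)

lemma HY_ultrafilter_HY_of_iff:
  assumes "strong_HY_ideal R Y I"
  shows "HY_ultrafilter R Y (HY_of Y I) \<longleftrightarrow> maximal_strong_HY_ideal R Y I"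
  using assms HY_ultrafilter_iff[OF HY_filter_HY_of] HY_inv_HY_of[OF assms]
  by (simp add: strong_HY_ideal_def)

section \<open>Maximal ideals when \<open>Max_Spec R \<subseteq> Y\<close>\<close>

lemma strong_HY_ideal_if_maximalideal:
  assumes "Max_Spec R \<subseteq> Y" and "maximalideal M R"
  shows "strong_HY_ideal R Y M"
proof -
  have "M \<in> Y"
    using assms by (auto simp: Max_Spec_def)
  then show ?thesis
    using maximalideal.axioms(1)[OF assms(2)] by (auto simp: strong_HY_ideal_def hY_def)
qed

lemma maximal_strong_HY_ideal_iff:
  assumes Max: "Max_Spec R \<subseteq> Y"
  shows "maximal_strong_HY_ideal R Y I \<longleftrightarrow> maximalideal I R"
proof
  assume I: "maximal_strong_HY_ideal R Y I"
  then obtain M where M: "maximalideal M R" "I \<subseteq> M"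
    using ex_maximalideal_superset[of I]
    by (auto simp: maximal_strong_HY_ideal_def strong_HY_ideal_def)
  \<comment> \<open>\<open>M\<close> is itself a proper strong ideal, so it competes with
    \<open>I\<close> in the maximality condition.\<close>
  then have "M = I"
    using I strong_HY_ideal_if_maximalideal[OF Max M(1)] maximalideal.I_notcarr[OF M(1)]
    by (auto simp: maximal_strong_HY_ideal_def)
  with M show "maximalideal I R"
    by simp
next
  assume I: "maximalideal I R"
  have "J = I" if "strong_HY_ideal R Y J" "J \<noteq> carrier R" "I \<subseteq> J" for J
    using that maximalideal.I_maximal[OF I, of J] ideal.Icarr[of J R]
    by (auto simp: strong_HY_ideal_def)
  then show "maximal_strong_HY_ideal R Y I"
    using strong_HY_ideal_if_maximalideal[OF Max I] maximalideal.I_notcarr[OF I]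
    by (auto simp: maximal_strong_HY_ideal_def)
qed

end

theorem theorem4p3:
  fixes R :: "('a, 'b) ring_scheme"
    and Y :: "'a set set" and I :: "'a set" and \<F> :: "'a set set set"
  assumes "cring R"
    and "Y \<subseteq> Spec R"
    and "ideal I R"
    and "HY_filter R Y \<F>"
  shows
    "(prime_strong_HY_ideal R Y (HY_inv R Y \<F>) \<longleftrightarrow> prime_HY_filter R Y \<F>)
     \<and> (strong_HY_ideal R Y I \<longrightarrow> (primeideal I R \<longleftrightarrow> prime_HY_filter R Y (HY_of Y I)))
     \<and> bij_betw (HY_of Y) {J. prime_strong_HY_ideal R Y J} {\<G>. prime_HY_filter R Y \<G>}
     \<and> ((maximal_strong_HY_ideal R Y I \<longleftrightarrow> (\<exists>\<G>. HY_ultrafilter R Y \<G> \<and> I = HY_inv R Y \<G>))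
        \<and> bij_betw (HY_of Y) {J. maximal_strong_HY_ideal R Y J} {\<G>. HY_ultrafilter R Y \<G>})
     \<and> (Max_Spec R \<subseteq> Y \<longrightarrow>
          (maximalideal I R \<longrightarrow> HY_ultrafilter R Y (HY_of Y I))
          \<and> (strong_HY_ideal R Y I \<longrightarrow> HY_ultrafilter R Y (HY_of Y I) \<longrightarrow> maximalideal I R))
     \<and> (Max_Spec R \<subseteq> Y \<longrightarrow>
          (HY_ultrafilter R Y \<F> \<longleftrightarrow> maximalideal (HY_inv R Y \<F>) R))"
proof (intro conjI impI)
  interpret spectrum_subset R Y
    using assms by (simp add: spectrum_subset_def spectrum_subset_axioms_def)
  note F = assms(4)
  have prime_filter: "HY_filter R Y \<G>" if "prime_HY_filter R Y \<G>" for \<G>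
    using that by (simp add: prime_HY_filter_def proper_HY_filter_def)
  have ultrafilter: "HY_filter R Y \<G>" if "HY_ultrafilter R Y \<G>" for \<G>
    using that by (simp add: HY_ultrafilter_def proper_HY_filter_def)
  have maximal_strong: "strong_HY_ideal R Y J" if "maximal_strong_HY_ideal R Y J" for J
    using that by (simp add: maximal_strong_HY_ideal_def)
  \<comment> \<open>Strongness is automatic for the ideal of a filter, so only primality has to be
    compared.\<close>
  show "prime_strong_HY_ideal R Y (HY_inv R Y \<F>) \<longleftrightarrow> prime_HY_filter R Y \<F>"
    using F by (simp add: prime_strong_HY_ideal_def strong_HY_ideal_HY_inv prime_HY_filter_iff)
  show "primeideal I R \<longleftrightarrow> prime_HY_filter R Y (HY_of Y I)" if "strong_HY_ideal R Y I"
    using that by (simp add: prime_HY_filter_HY_of_iff)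
  show "bij_betw (HY_of Y) {J. prime_strong_HY_ideal R Y J} {\<G>. prime_HY_filter R Y \<G>}"
    by (rule bij_betw_HY_of)
      (use prime_HY_filter_iff prime_filter prime_HY_filter_HY_of_iff strong_HY_ideal_HY_inv
        in \<open>unfold prime_strong_HY_ideal_def, blast+\<close>)
  \<comment> \<open>From left to right the witness is \<open>HY_of Y I\<close>, whose ideal is
    \<open>I\<close> because \<open>I\<close> is strong.\<close>
  show "maximal_strong_HY_ideal R Y I \<longleftrightarrow> (\<exists>\<G>. HY_ultrafilter R Y \<G> \<and> I = HY_inv R Y \<G>)"
    using HY_ultrafilter_iff ultrafilter HY_ultrafilter_HY_of_iff HY_inv_HY_of maximal_strong
    by metis
  show "bij_betw (HY_of Y) {J. maximal_strong_HY_ideal R Y J} {\<G>. HY_ultrafilter R Y \<G>}"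
    by (rule bij_betw_HY_of)
      (use HY_ultrafilter_iff ultrafilter HY_ultrafilter_HY_of_iff maximal_strong in blast)+
  show "HY_ultrafilter R Y (HY_of Y I)" if "Max_Spec R \<subseteq> Y" "maximalideal I R"
    using that
    by (simp add: HY_ultrafilter_HY_of_iff strong_HY_ideal_if_maximalideal
        maximal_strong_HY_ideal_iff)
  show "maximalideal I R"
    if "Max_Spec R \<subseteq> Y" "strong_HY_ideal R Y I" "HY_ultrafilter R Y (HY_of Y I)"
    using that by (simp add: HY_ultrafilter_HY_of_iff maximal_strong_HY_ideal_iff)
  show "HY_ultrafilter R Y \<F> \<longleftrightarrow> maximalideal (HY_inv R Y \<F>) R" if "Max_Spec R \<subseteq> Y"
    using that F by (simp add: HY_ultrafilter_iff maximal_strong_HY_ideal_iff)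
qed

end
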